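(* Let $T$ be the symmetric tridiagonal operator determined by sequences $a_n>0$, $b_n\in\mathbb{R}$ ($n\ge 1$), and let $m\in\mathbb{N}$, $m\ge1$. If $$\sum_{n=m+1}^\infty\frac{1}{a_nG_{m,n}}=\infty,\qquad G_{m,n}=\sum_{(\boldsymbol{j}_m|\boldsymbol{k}_m)\in\mathcal{I}_m}\frac{a_{n-k_1}}{|b_{n-j_1}|}\,\frac{a_{n-k_2}}{|b_{n-j_2}|}\cdots\frac{a_{n-k_m}}{|b_{n-j_m}|},$$ then $T$ is self-adjoint.
   Context: $(H,(\cdot,\cdot))$ is an infinite-dimensional complex Hilbert space with orthonormal basis $\{e_n\}_{n=1}^\infty$. Given real sequences $a_n>0$, $b_n\in\mathbb{R}$ ($n\ge1$), the formula $Te_n=a_ne_{n+1}+b_ne_n+a_{n-1}e_{n-1}$ (with $e_0=0$) defines a symmetric operator on the linear span of $\{e_n\}_{n=1}^\infty$; $T$ denotes the closure of this operator. Multi-indices: $\mathcal{I}_m$ is the set of pairs $(\boldsymbol{j}_m|\boldsymbol{k}_m)$ with $\boldsymbol{j}_m=(j_1,\dots,j_m)\in\mathbb{Z}^m$, $\boldsymbol{k}_m=(k_1,\dots,k_m)\in\mathbb{Z}^m$ such that $j_1=0$; for each $s=1,\dots,m-1$ either $k_s=j_s=j_{s+1}+1$ or $k_s=j_s+1=j_{s+1}$; and for $s=m$, $k_m=j_m$ or $k_m=j_m+1$ (negative values are allowed). For example $\mathcal{I}_1=\{(0|0),(0|1)\}$, so $G_{1,n}=(a_n+a_{n-1})/|b_n|$.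 Convention: a quotient with denominator $b_k=0$ is $+\infty$, so $G_{m,n}=\infty$ when one of the $b$'s occurring in it vanishes, and then $1/(a_nG_{m,n})=0$. *)

theory Defs
  imports "HOL-Analysis.Analysis"
begin

section \<open>Complex Hilbert spaces\<close>

text \<open>
  The inner product is linear in its first argument. The norm, the topology and completeness
  are those of the underlying real Banach space; the last axiom ties the norm to the inner
  product and makes the latter positive definite.
\<close>

class complex_hilbert_space = banach +
  fixes scaleC :: "complex \<Rightarrow> 'a \<Rightarrow> 'a"  (infixr \<open>*\<^sub>C\<close> 75)
    and cinner :: "'a \<Rightarrow> 'a \<Rightarrow> complex"
  assumes scaleC_add_right: "c *\<^sub>C (x + y) = c *\<^sub>C x + c *\<^sub>C y"
    and scaleC_add_left: "(c + d) *\<^sub>C x = c *\<^sub>C x + d *\<^sub>C x"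
    and scaleC_scaleC: "c *\<^sub>C d *\<^sub>C x = (c * d) *\<^sub>C x"
    and scaleR_scaleC: "r *\<^sub>R x = complex_of_real r *\<^sub>C x"
    and cinner_commute: "cinner x y = cnj (cinner y x)"
    and cinner_add_left: "cinner (x + y) z = cinner x z + cinner y z"
    and cinner_scaleC_left: "cinner (c *\<^sub>C x) y = c * cinner x y"
    and cinner_self: "cinner x x = complex_of_real ((norm x)\<^sup>2)"

lemma scaleC_one: "1 *\<^sub>C x = (x :: 'a::complex_hilbert_space)"
  using scaleR_scaleC[of 1 x] by simp

global_interpretation complex_vector:
  vector_space "scaleC :: complex \<Rightarrow> 'a \<Rightarrow> 'a::complex_hilbert_space"
  defines cspan = complex_vector.span
  by unfold_locales (simp_all add: scaleC_add_right scaleC_add_left scaleC_scaleC scaleC_one)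

definition orthonormal_basis :: "(nat \<Rightarrow> 'a::complex_hilbert_space) \<Rightarrow> bool" where
  "orthonormal_basis e \<longleftrightarrow>
     (\<forall>n\<ge>1. \<forall>k\<ge>1. cinner (e n) (e k) = (if n = k then 1 else 0)) \<and>
     closure (cspan (e ` {1..})) = UNIV"


section \<open>Unbounded operators\<close>

text \<open>
  An operator is represented by its graph, so that its domain is \<open>Domain T\<close> and its
  closure is the topological closure of \<open>T\<close> in the product space.
\<close>

definition linear_operator :: "('a::complex_hilbert_space \<times> 'a) set \<Rightarrow> bool" where
  "linear_operator T \<longleftrightarrow>
     single_valued T \<and> (0, 0) \<in> T \<and>
     (\<forall>(x, y)\<in>T. \<forall>(x', y')\<in>T. (x + x', y + y') \<in> T) \<and>
     (\<forall>c. \<forall>(x, y)\<in>T. (c *\<^sub>C x, c *\<^sub>C y) \<in> T)"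

definition adjoint_operator ::
  "('a::complex_hilbert_space \<times> 'a) set \<Rightarrow> ('a \<times> 'a) set" where
  "adjoint_operator T = {(y, z). \<forall>(x, w)\<in>T. cinner w y = cinner x z}"

definition self_adjoint :: "('a::complex_hilbert_space \<times> 'a) set \<Rightarrow> bool" where
  "self_adjoint T \<longleftrightarrow>
     linear_operator T \<and> closure (Domain T) = UNIV \<and> adjoint_operator T = T"


section \<open>The tridiagonal operator\<close>

text \<open>All sequences are indexed from 1; their values at 0 are irrelevant.\<close>

definition tridiagonal_image ::
  "(nat \<Rightarrow> 'a::complex_hilbert_space) \<Rightarrow> (nat \<Rightarrow> real) \<Rightarrow> (nat \<Rightarrow> real) \<Rightarrow> nat \<Rightarrow> 'a" where
  "tridiagonal_image e a b n =
     a n *\<^sub>R e (n + 1) + b n *\<^sub>R e n + (if n = 1 then 0 else a (n - 1) *\<^sub>R e (n - 1))"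

definition tridiagonal_on_span ::
  "(nat \<Rightarrow> 'a::complex_hilbert_space) \<Rightarrow> (nat \<Rightarrow> real) \<Rightarrow> (nat \<Rightarrow> real) \<Rightarrow> ('a \<times> 'a) set" where
  "tridiagonal_on_span e a b =
     {(\<Sum>n=1..N. c n *\<^sub>C e n, \<Sum>n=1..N. c n *\<^sub>C tridiagonal_image e a b n) | N c. True}"

definition tridiagonal_operator ::
  "(nat \<Rightarrow> 'a::complex_hilbert_space) \<Rightarrow> (nat \<Rightarrow> real) \<Rightarrow> (nat \<Rightarrow> real) \<Rightarrow> ('a \<times> 'a) set" where
  "tridiagonal_operator e a b = closure (tridiagonal_on_span e a b)"

lemma Domain_tridiagonal_on_span: "Domain (tridiagonal_on_span e a b) = cspan (e ` {1..})"
proof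
  show "Domain (tridiagonal_on_span e a b) \<subseteq> cspan (e ` {1..})"
    unfolding tridiagonal_on_span_def
    by (clarify, rule complex_vector.span_sum, rule complex_vector.span_scale,
        rule complex_vector.span_base) auto
next
  have cut: "(\<Sum>n=1..N. c n *\<^sub>C e n) = (\<Sum>n=1..M. (if n \<le> N then c n else 0) *\<^sub>C e n)"
    if "N \<le> M" for N M and c :: "nat \<Rightarrow> complex"
    using that by (intro sum.mono_neutral_cong_left) auto
  have dom: "x \<in> Domain (tridiagonal_on_span e a b) \<longleftrightarrow> (\<exists>N c. x = (\<Sum>n=1..N. c n *\<^sub>C e n))" for x
    by (auto simp: tridiagonal_on_span_def)
  have base: "\<exists>N c. e n = (\<Sum>i=1..N. c i *\<^sub>C e i)" if "n \<ge> 1" for n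
  proof (intro exI)
    have "(\<Sum>i=1..n. (if i = n then 1 else 0) *\<^sub>C e i) = (\<Sum>i\<in>{n}. (1 :: complex) *\<^sub>C e i)"
      using that by (intro sum.mono_neutral_cong_right) auto
    then show "e n = (\<Sum>i=1..n. (if i = n then 1 else 0) *\<^sub>C e i)"
      by simp
  qed
  have "complex_vector.subspace (Domain (tridiagonal_on_span e a b))"
    unfolding complex_vector.subspace_def dom
  proof (intro conjI ballI allI impI, goal_cases)
    case 1
    show ?case by (rule exI[of _ 0]) simp
  next
    case (2 x y)
    then obtain N c M d where xy: "x = (\<Sum>n=1..N. c n *\<^sub>C e n)" "y = (\<Sum>n=1..M. d n *\<^sub>C e n)"
      unfolding dom by blast
    have "x + y = (\<Sum>n=1..max N M. ((if n \<le> N then c n else 0) + (if n \<le> M then d n else 0)) *\<^sub>C e n)"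
      unfolding xy cut[OF max.cobounded1[of N M]] cut[OF max.cobounded2[of M N]]
      by (simp only: scaleC_add_left sum.distrib)
    then show ?case by (intro exI)
  next
    case (3 c x)
    then obtain N d where x: "x = (\<Sum>n=1..N. d n *\<^sub>C e n)"
      unfolding dom by blast
    have "c *\<^sub>C x = (\<Sum>n=1..N. (c * d n) *\<^sub>C e n)"
      unfolding x by (simp add: complex_vector.scale_sum_right)
    then show ?case by (intro exI)
  qed
  moreover have "e ` {1..} \<subseteq> Domain (tridiagonal_on_span e a b)"
    using base by (auto simp: dom)
  ultimately show "cspan (e ` {1..}) \<subseteq> Domain (tridiagonal_on_span e a b)"
    by (rule complex_vector.span_minimal[rotated])
qed


section \<open>The quantities in the criterion\<close>

text \<open>
  Multi-indices are pairs of integer lists of length \<open>m\<close>, so that the components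
  \<open>j\<^sub>s\<close>, \<open>k\<^sub>s\<close> with \<open>1 \<le> s \<le> m\<close> are \<open>js ! (s - 1)\<close>, \<open>ks ! (s - 1)\<close>.
\<close>

definition multi_indices :: "nat \<Rightarrow> (int list \<times> int list) set" where
  "multi_indices m = {(js, ks).
     length js = m \<and> length ks = m \<and> js ! 0 = 0 \<and>
     (\<forall>s\<in>{1..m-1}.
        ks ! (s - 1) = js ! (s - 1) \<and> js ! (s - 1) = js ! s + 1 \<or>
        ks ! (s - 1) = js ! (s - 1) + 1 \<and> js ! (s - 1) + 1 = js ! s) \<and>
     (ks ! (m - 1) = js ! (m - 1) \<or> ks ! (m - 1) = js ! (m - 1) + 1)}"

text \<open>
  In \<^typ>\<open>ennreal\<close> a positive number divided by 0 is \<open>\<infinity>\<close>, and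
  \<open>1 / \<infinity> = 0\<close>. For \<open>n > m\<close> all positions \<open>n - k\<^sub>s\<close>, \<open>n - j\<^sub>s\<close> are at least 1, so
  the truncation by \<^term>\<open>nat\<close> has no effect.
\<close>

definition G :: "(nat \<Rightarrow> real) \<Rightarrow> (nat \<Rightarrow> real) \<Rightarrow> nat \<Rightarrow> nat \<Rightarrow> ennreal" where
  "G a b m n =
     (\<Sum>(js, ks)\<in>multi_indices m. \<Prod>s=1..m.
        ennreal (a (nat (int n - ks ! (s - 1)))) / ennreal \<bar>b (nat (int n - js ! (s - 1)))\<bar>)"

lemma multi_indices_bounds:
  assumes "(js, ks) \<in> multi_indices m" "s < m"
  shows "\<bar>js ! s\<bar> \<le> int s" "ks ! s \<in> {js ! s, js ! s + 1}"
proof -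
  have step: "ks ! i = js ! i \<and> js ! i = js ! Suc i + 1 \<or>
      ks ! i = js ! i + 1 \<and> js ! i + 1 = js ! Suc i" if "Suc i < m" for i
    using assms(1) that by (auto simp: multi_indices_def dest!: bspec[of _ _ "Suc i"])
  show "\<bar>js ! s\<bar> \<le> int s"
    using assms(2)
  proof (induction s)
    case 0
    then show ?case using assms(1) by (simp add: multi_indices_def)
  next
    case (Suc i)
    then show ?case using step[of i] by auto
  qed
  show "ks ! s \<in> {js ! s, js ! s + 1}"
  proof (cases "Suc s < m")
    case True
    then show ?thesis using step[of s] by auto
  next
    case False
    then have "s = m - 1" using assms(2) by simp
    then show ?thesis using assms(1) by (auto simp: multi_indices_def)
  qed
qed

lemma finite_multi_indices: "finite (multi_indices m)"
proof (rule finite_subset)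
  let ?L = "{xs :: int list. set xs \<subseteq> {- int m..int m} \<and> length xs = m}"
  show "multi_indices m \<subseteq> ?L \<times> ?L"
  proof (clarsimp, intro conjI subsetI)
    fix js ks x assume *: "(js, ks) \<in> multi_indices m"
    then show len: "length js = m" "length ks = m"
      by (auto simp: multi_indices_def)
    show "x \<in> {- int m..int m}" if "x \<in> set js"
      using that multi_indices_bounds[OF *] len by (fastforce simp: in_set_conv_nth)
    show "x \<in> {- int m..int m}" if "x \<in> set ks"
      using that multi_indices_bounds[OF *] len by (fastforce simp: in_set_conv_nth)
  qed
  show "finite (?L \<times> ?L)"
    by (intro finite_SigmaI finite_lists_length_eq) auto
qed

lemma multi_indices_1: "multi_indices 1 = {([0], [0]), ([0], [1])}"
  by (auto simp: multi_indices_def length_Suc_conv)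

end

theory Submission
  imports Defs
begin

text \<open>
  If the deficiency spaces vanish, the range of \<open>T - \<i>\<close> is dense, and \<open>T\<close> equals its
  adjoint. A deficiency vector has square-summable coefficients \<open>u\<^sub>n\<close> solving the three-term
  recurrence with \<open>\<zeta> = \<plusminus> \<i>\<close>. If \<open>u \<noteq> 0\<close>, its Wronskian with its conjugate gives
  \<open>a\<^sub>n |u\<^sub>n| |u\<^sub>n\<^sub>+\<^sub>1| \<ge> c > 0\<close>. As \<open>|b\<^sub>n - \<zeta>| \<ge> |b\<^sub>n|\<close>, the recurrence bounds \<open>|u\<^sub>n|\<close> by
  \<open>(a\<^sub>n |u\<^sub>n\<^sub>+\<^sub>1| + a\<^sub>n\<^sub>-\<^sub>1 |u\<^sub>n\<^sub>-\<^sub>1|) / |b\<^sub>n|\<close>, and \<open>m\<close> iterations bound it by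
  \<open>G\<^sub>m\<^sub>,\<^sub>n\<close> times the sum of \<open>|u\<^sub>k|\<close> over \<open>|k - n| \<le> m\<close>. Hence \<open>1 / (a\<^sub>n G\<^sub>m\<^sub>,\<^sub>n)\<close> is at most
  \<open>1 / c\<close> times the sum of the products \<open>|u\<^sub>n\<^sub>+\<^sub>1| |u\<^sub>k|\<close>, whose series over \<open>n\<close> converges.
\<close>


section \<open>Geometry of complex Hilbert spaces\<close>

lemma cinner_add_right: "cinner x (y + z) = cinner x y + cinner x z"
  for x y z :: "'a::complex_hilbert_space"
  by (metis cinner_add_left cinner_commute complex_cnj_add)

lemma cinner_scaleC_right: "cinner x (c *\<^sub>C y) = cnj c * cinner x y"
  for x y :: "'a::complex_hilbert_space"
  by (metis cinner_scaleC_left cinner_commute complex_cnj_mult)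

lemma cinner_scaleR_left: "cinner (r *\<^sub>R x) y = r *\<^sub>R cinner x y"
  for x y :: "'a::complex_hilbert_space"
  by (simp add: scaleR_scaleC cinner_scaleC_left scaleR_conv_of_real)

lemma cinner_scaleR_right: "cinner x (r *\<^sub>R y) = r *\<^sub>R cinner x y"
  for x y :: "'a::complex_hilbert_space"
  by (simp add: scaleR_scaleC cinner_scaleC_right scaleR_conv_of_real)

lemma cinner_minus_left: "cinner (- x) y = - cinner x y"
  for x y :: "'a::complex_hilbert_space"
  using cinner_scaleR_left[of "-1" x y] by simp

lemma cinner_minus_right: "cinner x (- y) = - cinner x y"
  for x y :: "'a::complex_hilbert_space"
  using cinner_scaleR_right[of x "-1" y] by simp

lemma cinner_diff_left: "cinner (x - y) z = cinner x z - cinner y z"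
  for x y z :: "'a::complex_hilbert_space"
  using cinner_add_left[of x "- y" z] by (simp add: cinner_minus_left)

lemma cinner_diff_right: "cinner x (y - z) = cinner x y - cinner x z"
  for x y z :: "'a::complex_hilbert_space"
  using cinner_add_right[of x y "- z"] by (simp add: cinner_minus_right)

lemmas cinner_algebra = cinner_add_left cinner_add_right cinner_diff_left cinner_diff_right
  cinner_scaleC_left cinner_scaleC_right cinner_scaleR_left cinner_scaleR_right

text \<open>Pythagoras: the subtracted vector is the orthogonal projection of \<open>x\<close> onto
  the line through \<open>y\<close>. The identity serves twice, for Cauchy-Schwarz and for the
  orthogonality of a nearest-point residual.\<close>

lemma norm_square_diff_projection:
  fixes x y :: "'a::complex_hilbert_space"
  assumes "y \<noteq> 0"
  shows "(norm (x - (cinner x y / of_real ((norm y)\<^sup>2)) *\<^sub>C y))\<^sup>2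
    = (norm x)\<^sup>2 - (cmod (cinner x y))\<^sup>2 / (norm y)\<^sup>2"
proof -
  define N where "N = (complex_of_real ((norm y)\<^sup>2))"
  define p where "p = cinner x y"
  have N: "N \<noteq> 0" "cnj N = N" using assms by (auto simp: N_def)
  have yx: "cinner y x = cnj p" unfolding p_def by (rule cinner_commute)
  have yy: "cinner y y = N" unfolding N_def by (rule cinner_self)
  have "complex_of_real ((norm (x - (p / N) *\<^sub>C y))\<^sup>2)
      = cinner (x - (p / N) *\<^sub>C y) (x - (p / N) *\<^sub>C y)"
    by (simp only: cinner_self)
  also have "\<dots> = cinner x x - p * cnj p / N"
    using N by (simp add: cinner_algebra yx yy p_def[symmetric] field_simps)
  also have "\<dots> = complex_of_real ((norm x)\<^sup>2 - (cmod p)\<^sup>2 / (norm y)\<^sup>2)"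
    by (simp add: cinner_self N_def complex_norm_square[symmetric])
  finally show ?thesis
    unfolding N_def p_def of_real_eq_iff .
qed

lemma cinner_zero_right [simp]: "cinner x 0 = 0" for x :: "'a::complex_hilbert_space"
  using cinner_scaleR_right[of x 0 0] by simp

lemma norm_cinner_le: "cmod (cinner x y) \<le> norm x * norm y"
  for x y :: "'a::complex_hilbert_space"
proof (cases "y = 0")
  case False
  have "0 \<le> (norm x)\<^sup>2 - (cmod (cinner x y))\<^sup>2 / (norm y)\<^sup>2"
    unfolding norm_square_diff_projection[OF False, symmetric] by simp
  then have "(cmod (cinner x y))\<^sup>2 \<le> (norm x * norm y)\<^sup>2"
    using False by (simp add: field_simps power_mult_distrib)
  then show ?thesis
    by (rule power2_le_imp_le) simp
qed simp

text \<open>Boundedness with constant 1 is Cauchy-Schwarz. Bilinearity is over the reals only,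
  \<open>cinner\<close> being conjugate linear in its second argument; it supplies continuity and
  the rules for finite sums.\<close>

interpretation cinner: bounded_bilinear "cinner :: 'a::complex_hilbert_space \<Rightarrow> 'a \<Rightarrow> complex"
  by unfold_locales
    (auto simp: cinner_algebra intro!: exI[of _ 1] norm_cinner_le)

lemma norm_scaleC: "norm (c *\<^sub>C x) = cmod c * norm x"
  for x :: "'a::complex_hilbert_space"
proof -
  have "complex_of_real ((norm (c *\<^sub>C x))\<^sup>2) = c * cnj c * cinner x x"
    by (simp only: cinner_self[symmetric]) (simp add: cinner_algebra)
  also have "\<dots> = complex_of_real ((cmod c * norm x)\<^sup>2)"
    by (simp add: cinner_self complex_norm_square[symmetric] power_mult_distrib)
  finally show ?thesis
    unfolding of_real_eq_iff by (simp add: power2_eq_iff_nonneg)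
qed

lemma bounded_linear_scaleC: "bounded_linear (\<lambda>x :: 'a::complex_hilbert_space. c *\<^sub>C x)"
  by unfold_locales
    (auto simp: scaleC_add_right scaleR_scaleC scaleC_scaleC norm_scaleC mult.commute
      intro!: exI[of _ "cmod c"])

lemmas tendsto_scaleC [tendsto_intros] = bounded_linear.tendsto[OF bounded_linear_scaleC]

lemma parallelogram_law:
  "(norm (x + y))\<^sup>2 + (norm (x - y))\<^sup>2 = 2 * (norm x)\<^sup>2 + 2 * (norm y)\<^sup>2"
  for x y :: "'a::complex_hilbert_space"
proof -
  have "complex_of_real ((norm (x + y))\<^sup>2 + (norm (x - y))\<^sup>2)
      = complex_of_real (2 * (norm x)\<^sup>2 + 2 * (norm y)\<^sup>2)"
    by (simp only: of_real_add of_real_mult cinner_self[symmetric]) (simp add: cinner_algebra)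
  then show ?thesis unfolding of_real_eq_iff .
qed

text \<open>A sequence in \<open>V\<close> minimising the distance to \<open>f\<close> is Cauchy by
  the parallelogram law. Its limit \<open>w\<close> is a nearest point in the closure, so
  \<open>f - w\<close> is orthogonal to \<open>V\<close>, and the hypothesis gives
  \<open>f = w\<close>.\<close>

lemma subspace_dense_if_orthogonal_trivial:
  fixes V :: "'a::complex_hilbert_space set"
  assumes V: "complex_vector.subspace V"
    and orth: "\<And>v. (\<And>x. x \<in> V \<Longrightarrow> cinner x v = 0) \<Longrightarrow> v = 0"
  shows "closure V = UNIV"
proof -
  have "f \<in> closure V" for f
  proof -
    define d where "d = infdist f V"
    have ne: "V \<noteq> {}" using complex_vector.subspace_0[OF V] by auto
    have d0: "d \<ge> 0" by (simp add: d_def infdist_nonneg)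
    have "closure V \<subseteq> {x. d \<le> norm (f - x)}"
      by (intro closure_minimal closed_Collect_le continuous_intros)
        (auto simp: d_def dist_norm[symmetric] intro: infdist_le)
    then have le: "d \<le> norm (f - x)" if "x \<in> closure V" for x
      using that by auto
    have "\<exists>v\<in>V. norm (f - v) < d + 1 / real (Suc k)" for k
    proof (rule ccontr)
      assume "\<not> ?thesis"
      then have "d + 1 / real (Suc k) \<le> d"
        unfolding d_def infdist_notempty[OF ne]
        by (intro cINF_greatest) (auto simp: ne dist_norm infdist_notempty[OF ne] not_less)
      then show False by (simp add: field_simps)
    qed
    then obtain v where v: "\<And>k. v k \<in> V" "\<And>k. norm (f - v k) < d + 1 / real (Suc k)"
      by metis
    \<comment> \<open>The midpoint of \<open>v k\<close> and \<open>v l\<close> lies in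
      \<open>V\<close>, so the sum of the two residuals has norm at least \<open>2 * d\<close>. The
      parallelogram law leaves 4 (d + \<epsilon>)^2 - 4 d^2 for the difference, which is linear in
      \<epsilon> because \<epsilon> \<le> 1.\<close>
    have est: "(norm (v k - v l))\<^sup>2 \<le> (8 * d + 4) / real (Suc n)" if "k \<ge> n" "l \<ge> n" for k l n
    proof -
      define \<epsilon> where "\<epsilon> = 1 / real (Suc n)"
      have \<epsilon>: "0 < \<epsilon>" "\<epsilon> \<le> 1" by (auto simp: \<epsilon>_def)
      have near: "(norm (f - v i))\<^sup>2 \<le> (d + \<epsilon>)\<^sup>2" if "i \<ge> n" for i
      proof (rule power_mono)
        have "1 / real (Suc i) \<le> \<epsilon>" using that by (simp add: \<epsilon>_def frac_le)
        then show "norm (f - v i) \<le> d + \<epsilon>" using v(2)[of i] by linarith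
      qed simp
      have mid: "(1/2) *\<^sub>R (v k + v l) \<in> V"
        unfolding scaleR_scaleC
        using v(1) V by (intro complex_vector.subspace_scale complex_vector.subspace_add)
      have "norm ((f - v k) + (f - v l)) = norm (2 *\<^sub>R (f - (1/2) *\<^sub>R (v k + v l)))"
        by (simp add: scaleR_right_diff_distrib scaleR_2 add_diff_add)
      also have "\<dots> \<ge> 2 * d"
        using le[of "(1/2) *\<^sub>R (v k + v l)"] closure_subset[of V] mid by auto
      finally have "(2 * d)\<^sup>2 \<le> (norm ((f - v k) + (f - v l)))\<^sup>2"
        using d0 by (intro power_mono) auto
      moreover have "(norm ((f - v k) - (f - v l)))\<^sup>2 = (norm (v k - v l))\<^sup>2"
        by (simp add: norm_minus_commute)
      ultimately have "(norm (v k - v l))\<^sup>2 \<le> 4 * (d + \<epsilon>)\<^sup>2 - (2 * d)\<^sup>2"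
        using parallelogram_law[of "f - v k" "f - v l"] near[of k] near[of l] that by linarith
      also have "\<dots> = 8 * d * \<epsilon> + 4 * \<epsilon> * \<epsilon>" by (simp add: power2_eq_square algebra_simps)
      also have "\<dots> \<le> 8 * d * \<epsilon> + 4 * \<epsilon> * 1"
        using \<epsilon> by (intro add_left_mono mult_left_mono) auto
      also have "\<dots> = (8 * d + 4) / real (Suc n)"
        by (simp add: \<epsilon>_def add_divide_distrib)
      finally show ?thesis .
    qed
    have "Cauchy v"
    proof (rule metric_CauchyI)
      fix r :: real assume r: "r > 0"
      obtain n where n: "(8 * d + 4) / r\<^sup>2 < real n" using reals_Archimedean2 by blast
      have "norm (v k - v l) < r" if "k \<ge> n" "l \<ge> n" for k l
      proof (rule power2_less_imp_less)
        have "(8 * d + 4) / r\<^sup>2 < real (Suc n)" using n by simp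
        then have "(8 * d + 4) / real (Suc n) < r\<^sup>2"
          using r by (simp add: field_simps)
        then show "(norm (v k - v l))\<^sup>2 < r\<^sup>2" using est[OF that] by linarith
      qed (use r in auto)
      then show "\<exists>M. \<forall>m\<ge>M. \<forall>n\<ge>M. dist (v m) (v n) < r"
        by (auto simp: dist_norm)
    qed
    then obtain w where w: "v \<longlonglongrightarrow> w"
      using Cauchy_convergent_iff convergent_def by blast
    have wV: "w \<in> closure V" using v(1) w closure_sequential by blast
    have "(\<lambda>k. d + 1 / real (Suc k)) \<longlonglongrightarrow> d + 0"
      by (intro tendsto_intros LIMSEQ_Suc[OF lim_1_over_n])
    moreover have "(\<lambda>k. norm (f - v k)) \<longlonglongrightarrow> norm (f - w)" by (intro tendsto_intros w)
    ultimately have wd: "norm (f - w) \<le> d"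
      using v(2) by (intro LIMSEQ_le[of "\<lambda>k. norm (f - v k)" _ "\<lambda>k. d + 1 / real (Suc k)"])
        (auto intro: less_imp_le)
    have "cinner (f - w) x = 0" if x: "x \<in> V" for x
    proof (rule ccontr)
      assume ne0: "cinner (f - w) x \<noteq> 0"
      then have x0: "x \<noteq> 0" by auto
      \<comment> \<open>Moving \<open>w\<close> by the projection of the residual onto
        \<open>x\<close> stays in the closure but would come strictly closer to \<open>f\<close>
        than \<open>d\<close>.\<close>
      define c where "c = cinner (f - w) x / complex_of_real ((norm x)\<^sup>2)"
      have lim: "(\<lambda>k. v k + c *\<^sub>C x) \<longlonglongrightarrow> w + c *\<^sub>C x" by (intro tendsto_intros w)
      have "v k + c *\<^sub>C x \<in> V" for k
        using v(1) x V by (intro complex_vector.subspace_add complex_vector.subspace_scale)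
      with lim have "w + c *\<^sub>C x \<in> closure V"
        unfolding closure_sequential by (intro exI[of _ "\<lambda>k. v k + c *\<^sub>C x"]) simp
      then have "d \<le> norm (f - w - c *\<^sub>C x)" using le by (fastforce simp: algebra_simps)
      then have "d\<^sup>2 \<le> (norm (f - w - c *\<^sub>C x))\<^sup>2" using d0 by (intro power_mono) auto
      also have "\<dots> = (norm (f - w))\<^sup>2 - (cmod (cinner (f - w) x))\<^sup>2 / (norm x)\<^sup>2"
        unfolding c_def by (rule norm_square_diff_projection[OF x0])
      also have "\<dots> < (norm (f - w))\<^sup>2" using ne0 x0 by simp
      also have "\<dots> \<le> d\<^sup>2" using wd by (intro power_mono) auto
      finally show False by simp
    qed
    then have "f - w = 0"
      by (intro orth) (metis cinner_commute complex_cnj_zero)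
    with wV show ?thesis by simp
  qed
  then show ?thesis by auto
qed

text \<open>The sum is the squared norm of the orthogonal projection \<open>p\<close> of
  \<open>y\<close> onto the span of the \<open>e n\<close>, and it differs from that of
  \<open>y\<close> by the square of \<open>norm (y - p)\<close>.\<close>

lemma bessel_inequality:
  fixes e :: "nat \<Rightarrow> 'a::complex_hilbert_space"
  assumes e: "\<And>n k. n \<in> I \<Longrightarrow> k \<in> I \<Longrightarrow> cinner (e n) (e k) = (if n = k then 1 else 0)"
    and fin: "finite I"
  shows "(\<Sum>n\<in>I. (cmod (cinner (e n) y))\<^sup>2) \<le> (norm y)\<^sup>2"
proof -
  define p where "p = (\<Sum>n\<in>I. cinner y (e n) *\<^sub>C e n)"
  define S where "S = (\<Sum>n\<in>I. (cmod (cinner (e n) y))\<^sup>2)"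
  have sq: "cinner y (e n) * cinner (e n) y = complex_of_real ((cmod (cinner (e n) y))\<^sup>2)" for n
    by (subst cinner_commute) (simp add: complex_norm_square[symmetric] mult.commute)
  have ep: "cinner (e n) p = cinner (e n) y" if "n \<in> I" for n
  proof -
    have "cinner (e n) p = (\<Sum>k\<in>I. if n = k then cinner (e n) y else 0)"
      unfolding p_def cinner.sum_right using that
      by (intro sum.cong) (auto simp: cinner_scaleC_right e cinner_commute[symmetric])
    also have "\<dots> = cinner (e n) y" using that fin by simp
    finally show ?thesis .
  qed
  have py: "cinner p y = of_real S"
    by (simp add: p_def cinner.sum_left cinner_scaleC_left sq S_def)
  have "cinner p p = (\<Sum>n\<in>I. cinner y (e n) * cinner (e n) p)"
    by (subst (1) p_def) (simp add: cinner.sum_left cinner_scaleC_left)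
  also have "\<dots> = of_real S"
    by (simp add: ep sq S_def)
  finally have pp: "cinner p p = of_real S" .
  have yp: "cinner y p = of_real S" using py cinner_commute[of y p] by simp
  have "complex_of_real ((norm (y - p))\<^sup>2) = complex_of_real ((norm y)\<^sup>2 - S)"
    by (simp only: cinner_self[symmetric] of_real_diff) (simp add: cinner_algebra pp py yp)
  then have "(norm (y - p))\<^sup>2 = (norm y)\<^sup>2 - S" unfolding of_real_eq_iff .
  then have "0 \<le> (norm y)\<^sup>2 - S" by (metis zero_le_power2)
  then show ?thesis by (simp add: S_def)
qed

text \<open>The vectors orthogonal to \<open>y\<close> form a closed subspace containing
  \<open>S\<close>, hence the whole space and in particular \<open>y\<close> itself.\<close>

lemma dense_orthogonal_zero:
  fixes y :: "'a::complex_hilbert_space"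
  assumes dense: "closure (cspan S) = UNIV" and orth: "\<And>x. x \<in> S \<Longrightarrow> cinner x y = 0"
  shows "y = 0"
proof -
  have "closed {x. cinner x y = 0}"
    by (intro closed_Collect_eq continuous_intros cinner.continuous_on)
  moreover have "cspan S \<subseteq> {x. cinner x y = 0}"
    by (rule complex_vector.span_minimal)
      (auto simp: orth complex_vector.subspace_def cinner_algebra cinner.zero_left)
  ultimately have "closure (cspan S) \<subseteq> {x. cinner x y = 0}" by (rule closure_minimal[rotated])
  then have "cinner y y = 0" using dense by auto
  then show ?thesis by (simp add: cinner_self)
qed


section \<open>The basic criterion for self-adjointness\<close>

text \<open>For a fixed pair \<open>(y, z)\<close> the defining identity is a closed condition on
  the graph, so it passes from \<open>T\<close> to its closure.\<close>

lemma adjoint_operator_closure: "adjoint_operator (closure T) = adjoint_operator T"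
proof
  show "adjoint_operator (closure T) \<subseteq> adjoint_operator T"
    using closure_subset[of T] by (auto simp: adjoint_operator_def)
next
  have "closure T \<subseteq> {p. cinner (snd p) y = cinner (fst p) z}" if "(y, z) \<in> adjoint_operator T" for y z
    using that
    by (intro closure_minimal closed_Collect_eq cinner.continuous_on continuous_intros)
      (auto simp: adjoint_operator_def)
  then show "adjoint_operator T \<subseteq> adjoint_operator (closure T)"
    unfolding adjoint_operator_def[of "closure T"] by fastforce
qed

lemma closed_adjoint_operator: "closed (adjoint_operator T)"
proof -
  have "adjoint_operator T = (\<Inter>(x, w)\<in>T. {p. cinner w (fst p) = cinner x (snd p)})"
    by (auto simp: adjoint_operator_def)
  moreover have "closed {p. cinner w (fst p) = cinner x (snd p)}" for x w :: 'a
    by (intro closed_Collect_eq cinner.continuous_on continuous_intros)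
  then have "closed (\<Inter>(x, w)\<in>T. {p. cinner w (fst p) = cinner x (snd p)})"
    by (intro closed_INT) auto
  ultimately show ?thesis by simp
qed

lemma adjoint_operator_diff:
  "(y, z) \<in> adjoint_operator T \<Longrightarrow> (y', z') \<in> adjoint_operator T
    \<Longrightarrow> (y - y', z - z') \<in> adjoint_operator T"
  by (fastforce simp: adjoint_operator_def cinner_diff_right)

text \<open>The second kernel condition makes the range of T - \<i> dense. Symmetry gives a norm
  identity that makes the range of the closure minus \<i> everything. The first kernel condition
  then shows that the adjoint cannot properly extend the closure.\<close>

lemma self_adjoint_closureI:
  fixes T :: "('a::complex_hilbert_space \<times> 'a) set"
  assumes zero: "(0, 0) \<in> T"
    and add: "\<And>x y x' y'. (x, y) \<in> T \<Longrightarrow> (x', y') \<in> T \<Longrightarrow> (x + x', y + y') \<in> T"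
    and scale: "\<And>c x y. (x, y) \<in> T \<Longrightarrow> (c *\<^sub>C x, c *\<^sub>C y) \<in> T"
    and dense: "closure (Domain T) = UNIV"
    and symmetric: "T \<subseteq> adjoint_operator T"
    and kernel: "\<And>y. (y, \<i> *\<^sub>C y) \<in> adjoint_operator T \<Longrightarrow> y = 0"
      "\<And>y. (y, (-\<i>) *\<^sub>C y) \<in> adjoint_operator T \<Longrightarrow> y = 0"
  shows "self_adjoint (closure T)"
proof -
  let ?A = "adjoint_operator T"
  have TA: "closure T \<subseteq> ?A"
    by (intro closure_minimal symmetric closed_adjoint_operator)
  have diff: "(x - x', y - y') \<in> T" if "(x, y) \<in> T" "(x', y') \<in> T" for x y x' y'
    using add[OF that(1) scale[OF that(2), of "-1"]]
    by (simp add: complex_vector.scale_minus_left scaleC_one)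

  \<comment> \<open>Two images of one vector differ by a vector orthogonal to the dense
    domain.\<close>
  have sv: "single_valued ?A"
  proof (rule single_valuedI)
    fix y z z' assume "(y, z) \<in> ?A" "(y, z') \<in> ?A"
    then have "(0, z - z') \<in> ?A" using adjoint_operator_diff[of y z T y z'] by simp
    then have "\<forall>x\<in>Domain T. cinner x (z - z') = 0" by (auto simp: adjoint_operator_def)
    moreover have "complex_vector.subspace (Domain T)"
      unfolding complex_vector.subspace_def using zero add scale by blast
    then have "closure (cspan (Domain T)) = UNIV"
      using dense by (simp add: complex_vector.span_eq_iff[THEN iffD2])
    ultimately have "z - z' = 0"
      by (intro dense_orthogonal_zero[of "Domain T"]) auto
    then show "z = z'" by simp
  qed

  have lin: "linear_operator (closure T)"
    unfolding linear_operator_def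
  proof (intro conjI)
    show "single_valued (closure T)" using single_valued_subset[OF TA sv] .
    show "(0, 0) \<in> closure T" using zero closure_subset by blast
    show "\<forall>(x, y)\<in>closure T. \<forall>(x', y')\<in>closure T. (x + x', y + y') \<in> closure T"
    proof clarify
      fix x y x' y' assume "(x, y) \<in> closure T" "(x', y') \<in> closure T"
      then obtain f g where fg: "\<And>n. f n \<in> T" "f \<longlonglongrightarrow> (x, y)" "\<And>n. g n \<in> T" "g \<longlonglongrightarrow> (x', y')"
        unfolding closure_sequential by blast
      have "f n + g n \<in> T" for n
        using add[of "fst (f n)" "snd (f n)" "fst (g n)" "snd (g n)"] fg by (simp add: plus_prod_def)
      moreover have "(\<lambda>n. f n + g n) \<longlonglongrightarrow> (x, y) + (x', y')" by (intro tendsto_intros fg)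
      ultimately show "(x + x', y + y') \<in> closure T"
        unfolding closure_sequential by (intro exI[of _ "\<lambda>n. f n + g n"]) simp
    qed
    show "\<forall>c. \<forall>(x, y)\<in>closure T. (c *\<^sub>C x, c *\<^sub>C y) \<in> closure T"
    proof clarify
      fix c x y assume "(x, y) \<in> closure T"
      then obtain f where f: "\<And>n. f n \<in> T" "f \<longlonglongrightarrow> (x, y)"
        unfolding closure_sequential by blast
      have "(c *\<^sub>C fst (f n), c *\<^sub>C snd (f n)) \<in> T" for n
        using scale[of "fst (f n)" "snd (f n)"] f by simp
      moreover have "(\<lambda>n. (c *\<^sub>C fst (f n), c *\<^sub>C snd (f n))) \<longlonglongrightarrow> (c *\<^sub>C fst (x, y), c *\<^sub>C snd (x, y))"
        by (intro tendsto_Pair tendsto_scaleC tendsto_fst tendsto_snd f)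
      ultimately show "(c *\<^sub>C x, c *\<^sub>C y) \<in> closure T"
        unfolding closure_sequential
        by (intro exI[of _ "\<lambda>n. (c *\<^sub>C fst (f n), c *\<^sub>C snd (f n))"]) simp
    qed
  qed

  define V where "V = (\<lambda>(x, w). w - \<i> *\<^sub>C x) ` T"
  have "complex_vector.subspace V"
    unfolding complex_vector.subspace_def
  proof (intro conjI ballI allI)
    show "0 \<in> V" unfolding V_def using zero by (force simp: complex_vector.scale_zero_right)
  next
    fix p q assume "p \<in> V" "q \<in> V"
    then obtain x w x' w' where "(x, w) \<in> T" "p = w - \<i> *\<^sub>C x" "(x', w') \<in> T" "q = w' - \<i> *\<^sub>C x'"
      unfolding V_def by auto
    moreover from this have "(x + x', w + w') \<in> T" by (intro add)
    ultimately show "p + q \<in> V"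
      unfolding V_def by (intro image_eqI[of _ _ "(x + x', w + w')"]) (auto simp: scaleC_add_right)
  next
    fix c p assume "p \<in> V"
    then obtain x w where "(x, w) \<in> T" "p = w - \<i> *\<^sub>C x" unfolding V_def by auto
    moreover from this have "(c *\<^sub>C x, c *\<^sub>C w) \<in> T" by (intro scale)
    ultimately show "c *\<^sub>C p \<in> V"
      unfolding V_def
      by (intro image_eqI[of _ _ "(c *\<^sub>C x, c *\<^sub>C w)"])
        (auto simp: complex_vector.scale_right_diff_distrib scaleC_scaleC mult.commute)
  qed
  \<comment> \<open>Conjugate linearity in the second argument turns \<i> into -\<i>: a vector
    orthogonal to the range of T - \<i> is an eigenvector of the adjoint for -\<i>, or zero.\<close>
  moreover have "v = 0" if "\<And>x. x \<in> V \<Longrightarrow> cinner x v = 0" for v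
  proof (rule kernel(2))
    have "cinner (w - \<i> *\<^sub>C x) v = 0" if "(x, w) \<in> T" for x w
      using \<open>\<And>x. x \<in> V \<Longrightarrow> cinner x v = 0\<close> that unfolding V_def by force
    then show "(v, (-\<i>) *\<^sub>C v) \<in> ?A"
      by (auto simp: adjoint_operator_def cinner_algebra cinner_minus_right)
  qed
  ultimately have V: "closure V = UNIV" by (rule subspace_dense_if_orthogonal_trivial)

  \<comment> \<open>The two cross terms cancel because \<open>T\<close> is symmetric.\<close>
  have iso: "(norm (w - \<i> *\<^sub>C x))\<^sup>2 = (norm w)\<^sup>2 + (norm x)\<^sup>2" if "(x, w) \<in> T" for x w
  proof -
    have *: "cinner w x = cinner x w"
      using symmetric that by (auto simp: adjoint_operator_def)
    have "complex_of_real ((norm (w - \<i> *\<^sub>C x))\<^sup>2) = complex_of_real ((norm w)\<^sup>2 + (norm x)\<^sup>2)"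
      by (simp only: cinner_self[symmetric] of_real_add) (simp add: cinner_algebra * algebra_simps)
    then show ?thesis unfolding of_real_eq_iff .
  qed

  have "?A \<subseteq> closure T"
  proof clarify
    fix y z assume yz: "(y, z) \<in> ?A"
    obtain g where g: "\<And>n. g n \<in> V" "g \<longlonglongrightarrow> z - \<i> *\<^sub>C y"
      using V unfolding closure_sequential set_eq_iff by blast
    have "\<exists>x w. (x, w) \<in> T \<and> g n = w - \<i> *\<^sub>C x" for n using g(1)[of n] unfolding V_def by auto
    then obtain x w where xw: "\<And>n. (x n, w n) \<in> T" "\<And>n. g n = w n - \<i> *\<^sub>C x n"
      by metis
    \<comment> \<open>Applied to differences, \<open>iso\<close> makes both components Cauchy as
      soon as \<open>g\<close> is. This is the boundedness of the inverse of T - \<i>.\<close>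
    have le: "norm (w k - w l) \<le> norm (g k - g l) \<and> norm (x k - x l) \<le> norm (g k - g l)" for k l
    proof -
      have "g k - g l = (w k - w l) - \<i> *\<^sub>C (x k - x l)"
        by (simp add: xw(2) complex_vector.scale_right_diff_distrib)
      then have "(norm (g k - g l))\<^sup>2 = (norm (w k - w l))\<^sup>2 + (norm (x k - x l))\<^sup>2"
        using iso[OF diff[OF xw(1)[of k] xw(1)[of l]]] by simp
      then have "(norm (w k - w l))\<^sup>2 \<le> (norm (g k - g l))\<^sup>2"
        "(norm (x k - x l))\<^sup>2 \<le> (norm (g k - g l))\<^sup>2" by simp_all
      then show ?thesis by (meson norm_ge_zero power2_le_imp_le)
    qed
    have "Cauchy g" using g(2) LIMSEQ_imp_Cauchy by blast
    then have "Cauchy x" "Cauchy w"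
      unfolding Cauchy_def dist_norm using le by (meson order.strict_trans1)+
    then obtain x' w' where lim: "x \<longlonglongrightarrow> x'" "w \<longlonglongrightarrow> w'"
      using Cauchy_convergent_iff convergent_def by metis
    have "(\<lambda>n. (x n, w n)) \<longlonglongrightarrow> (x', w')" by (intro tendsto_Pair lim)
    then have cl: "(x', w') \<in> closure T"
      unfolding closure_sequential using xw(1) by (intro exI[of _ "\<lambda>n. (x n, w n)"]) auto
    have "g \<longlonglongrightarrow> w' - \<i> *\<^sub>C x'" unfolding xw(2) by (intro tendsto_intros lim)
    then have "w' - \<i> *\<^sub>C x' = z - \<i> *\<^sub>C y" using g(2) LIMSEQ_unique by blast
    then have eq: "z - w' = \<i> *\<^sub>C (y - x')"
      by (simp add: complex_vector.scale_right_diff_distrib algebra_simps)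
    \<comment> \<open>The pair found in the closure has the same image under T - \<i> as
      \<open>(y, z)\<close>, so the difference solves the eigenvalue equation for \<i>.\<close>
    have "(y - x', z - w') \<in> ?A" using adjoint_operator_diff yz cl TA by blast
    then have "y - x' = 0" unfolding eq by (rule kernel(1))
    then have "y = x'" "z = w'" using eq by simp_all
    then show "(y, z) \<in> closure T" using cl by simp
  qed
  then have "adjoint_operator (closure T) = closure T"
    using TA by (auto simp: adjoint_operator_closure)
  moreover have "closure (Domain (closure T)) = UNIV"
    using closure_mono[OF Domain_mono[OF closure_subset[of T]]] dense by auto
  ultimately show ?thesis using lin unfolding self_adjoint_def by blast
qed


section \<open>The three-term recurrence\<close>

text \<open>Multiply the recurrence by \<open>cnj (u n)\<close> and take imaginary parts: the term
  with the real \<open>b n\<close> drops out, the terms with \<open>a\<close> telescope, and each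
  index contributes Im \<zeta> times the squared modulus of \<open>u n\<close>.\<close>

lemma recurrence_wronskian:
  fixes u :: "nat \<Rightarrow> complex" and a b :: "nat \<Rightarrow> real" and \<zeta> :: complex
  assumes rec: "\<And>n. n \<ge> 1 \<Longrightarrow>
      a n * u (n + 1) + b n * u n + (if n = 1 then 0 else a (n - 1) * u (n - 1)) = \<zeta> * u n"
    and "n \<ge> 1"
  shows "a n * Im (u (n + 1) * cnj (u n)) = Im \<zeta> * (\<Sum>k=1..n. (cmod (u k))\<^sup>2)"
  using \<open>n \<ge> 1\<close>
proof (induction n rule: dec_induct)
  case base
  show ?case
    using arg_cong[OF rec[of 1], of "\<lambda>x. Im (x * cnj (u 1))"]
    by (simp add: algebra_simps cmod_power2) (simp add: power2_eq_square algebra_simps)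
next
  case (step n)
  have "a (n + 1) * Im (u (n + 2) * cnj (u (n + 1)))
      = Im \<zeta> * (cmod (u (n + 1)))\<^sup>2 + a n * Im (u (n + 1) * cnj (u n))"
    using arg_cong[OF rec[of "n + 1"], of "\<lambda>x. Im (x * cnj (u (n + 1)))"] step.hyps
    by (simp add: algebra_simps cmod_power2) (simp add: power2_eq_square algebra_simps)
  then show ?case
    using step by (simp add: algebra_simps)
qed

text \<open>As \<open>a k\<close> does not vanish, the recurrence at \<open>k\<close> determines
  \<open>u (k + 1)\<close> from earlier values, and at \<open>k = 1\<close> from \<open>u 1\<close>
  alone.\<close>

lemma recurrence_zero:
  fixes u :: "nat \<Rightarrow> complex" and a b :: "nat \<Rightarrow> real" and \<zeta> :: complex
  assumes rec: "\<And>n. n \<ge> 1 \<Longrightarrow>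
      a n * u (n + 1) + b n * u n + (if n = 1 then 0 else a (n - 1) * u (n - 1)) = \<zeta> * u n"
    and a: "\<And>n. n \<ge> 1 \<Longrightarrow> a n > 0" and "u 1 = 0" and "n \<ge> 1"
  shows "u n = 0"
  using \<open>n \<ge> 1\<close>
proof (induction n rule: less_induct)
  case (less n)
  show ?case
  proof (cases "n = 1")
    case False
    define k where "k = n - 1"
    have k: "n = k + 1" "k \<ge> 1" using False less.prems by (auto simp: k_def)
    have "u k = 0" "k \<noteq> 1 \<Longrightarrow> u (k - 1) = 0" using k less.IH by auto
    then have "a k * u n = 0" using rec[of k] k by (auto split: if_splits)
    then show ?thesis using a[of k] k by simp
  qed (use assms in simp)
qed

section \<open>Multi-indices as nearest-neighbour paths, and iteration of the recurrence\<close>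

text \<open>Both alternatives at position s amount to j_{s+1} = 2 k_s - j_s - 1. So the next j is
  forced by the prefix, and the only new freedom is d = k - j in {0, 1}.\<close>

lemma multi_indices_Suc:
  assumes "m \<ge> 1"
  shows "multi_indices (Suc m) =
    (\<lambda>((js, ks), d). let j = 2 * ks ! (m - 1) - js ! (m - 1) - 1 in (js @ [j], ks @ [j + d])) `
      (multi_indices m \<times> {0, 1})" (is "_ = ?f ` _")
proof (intro equalityI subsetI)
  fix p assume "p \<in> multi_indices (Suc m)"
  then obtain js ks where p: "p = (js, ks)" and mem: "(js, ks) \<in> multi_indices (Suc m)"
    by (cases p) auto
  then have len: "length js = Suc m" "length ks = Suc m" by (auto simp: multi_indices_def)
  have split: "js = take m js @ [js ! m]" "ks = take m ks @ [ks ! m]"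
    using len by (metis take_Suc_conv_app_nth lessI take_all order_refl)+
  have bd: "ks ! m = js ! m \<or> ks ! m = js ! m + 1"
    using mem by (auto simp: multi_indices_def)
  have st: "ks ! (s - 1) = js ! (s - 1) \<and> js ! (s - 1) = js ! s + 1 \<or>
        ks ! (s - 1) = js ! (s - 1) + 1 \<and> js ! (s - 1) + 1 = js ! s" if "1 \<le> s" "s \<le> m" for s
    using mem that by (auto simp: multi_indices_def)
  have "(take m js, take m ks) \<in> multi_indices m"
    unfolding multi_indices_def mem_Collect_eq prod.case
  proof (intro conjI ballI)
    show "take m js ! 0 = 0" using mem assms by (simp add: multi_indices_def)
    show "take m ks ! (m - 1) = take m js ! (m - 1) \<or> take m ks ! (m - 1) = take m js ! (m - 1) + 1"
      using st[of m] assms by auto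
    fix s assume "s \<in> {1..m - 1}"
    then show "take m ks ! (s - 1) = take m js ! (s - 1) \<and> take m js ! (s - 1) = take m js ! s + 1 \<or>
        take m ks ! (s - 1) = take m js ! (s - 1) + 1 \<and> take m js ! (s - 1) + 1 = take m js ! s"
      using st[of s] by auto
  qed (use len in auto)
  moreover have "p = ?f ((take m js, take m ks), ks ! m - js ! m)"
  proof -
    have "p = (take m js @ [js ! m], take m ks @ [ks ! m])"
      unfolding p by (intro arg_cong2[of _ _ _ _ Pair] split)
    moreover have "js ! m = 2 * take m ks ! (m - 1) - take m js ! (m - 1) - 1"
      using st[of m] assms by auto
    ultimately show ?thesis by (simp add: Let_def)
  qed
  moreover have "ks ! m - js ! m \<in> {0, 1}" using bd by auto
  ultimately show "p \<in> ?f ` (multi_indices m \<times> {0, 1})" by blast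
next
  fix p assume "p \<in> ?f ` (multi_indices m \<times> {0, 1})"
  then obtain js ks d where mem: "(js, ks) \<in> multi_indices m" and d: "d = 0 \<or> d = 1"
    and p: "p = ?f ((js, ks), d)" by auto
  then have len: "length js = m" "length ks = m" by (auto simp: multi_indices_def)
  have st: "ks ! (s - 1) = js ! (s - 1) \<and> js ! (s - 1) = js ! s + 1 \<or>
        ks ! (s - 1) = js ! (s - 1) + 1 \<and> js ! (s - 1) + 1 = js ! s" if "1 \<le> s" "s < m" for s
    using mem that by (auto simp: multi_indices_def)
  have bd: "ks ! (m - 1) = js ! (m - 1) \<or> ks ! (m - 1) = js ! (m - 1) + 1" and "js ! 0 = 0"
    using mem by (auto simp: multi_indices_def)
  define j where "j = 2 * ks ! (m - 1) - js ! (m - 1) - 1"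
  have step: "(ks @ [j + d]) ! (s - 1) = (js @ [j]) ! (s - 1) \<and> (js @ [j]) ! (s - 1) = (js @ [j]) ! s + 1 \<or>
        (ks @ [j + d]) ! (s - 1) = (js @ [j]) ! (s - 1) + 1 \<and> (js @ [j]) ! (s - 1) + 1 = (js @ [j]) ! s"
    if "1 \<le> s" "s \<le> m" for s
  proof (cases "s = m")
    case True
    then show ?thesis using bd assms len by (auto simp: nth_append j_def)
  next
    case False
    then have "s < m" "s - 1 < m" using that by auto
    then show ?thesis using st[of s] that len by (simp add: nth_append)
  qed
  have "(js @ [j], ks @ [j + d]) \<in> multi_indices (Suc m)"
    unfolding multi_indices_def using step len d \<open>js ! 0 = 0\<close> assms
    by (auto simp: nth_append)
  then show "p \<in> multi_indices (Suc m)" unfolding p by (simp add: j_def Let_def)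
qed

text \<open>The extension map is injective, since the prefix and \<open>d\<close> can be read off
  the longer lists; reindexing gives the inductive step for sums over paths.\<close>

lemma sum_multi_indices_Suc:
  assumes "m \<ge> 1"
  shows "(\<Sum>(js, ks)\<in>multi_indices (Suc m). F js ks) =
    (\<Sum>(js, ks)\<in>multi_indices m. let j = 2 * ks ! (m - 1) - js ! (m - 1) - 1 in
       F (js @ [j]) (ks @ [j]) + F (js @ [j]) (ks @ [j + 1]))"
proof -
  let ?f = "\<lambda>((js, ks), d). let j = 2 * ks ! (m - 1) - js ! (m - 1) - 1 in (js @ [j], ks @ [j + d])"
  have inj: "inj_on ?f (multi_indices m \<times> {0, 1 :: int})"
    by (auto simp: inj_on_def Let_def)
  have "(\<Sum>(js, ks)\<in>multi_indices (Suc m). F js ks)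
      = (\<Sum>q\<in>multi_indices m \<times> {0, 1 :: int}. (\<lambda>(js, ks). F js ks) (?f q))"
    unfolding multi_indices_Suc[OF assms] by (subst sum.reindex[OF inj]) simp
  also have "\<dots> = (\<Sum>p\<in>multi_indices m. \<Sum>d\<in>{0, 1 :: int}. (\<lambda>(js, ks). F js ks) (?f (p, d)))"
    by (subst sum.cartesian_product) (simp add: case_prod_unfold)
  also have "\<dots> = (\<Sum>(js, ks)\<in>multi_indices m. let j = 2 * ks ! (m - 1) - js ! (m - 1) - 1 in
       F (js @ [j]) (ks @ [j]) + F (js @ [j]) (ks @ [j + 1]))"
    by (intro sum.cong) (auto simp: Let_def)
  finally show ?thesis .
qed

text \<open>The summand of \<open>G\<close> for a single multi-index, isolated so that paths can be
  extended one step at a time.\<close>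

definition path_weight ::
  "(nat \<Rightarrow> real) \<Rightarrow> (nat \<Rightarrow> real) \<Rightarrow> nat \<Rightarrow> nat \<Rightarrow> int list \<Rightarrow> int list \<Rightarrow> ennreal" where
  "path_weight a b m n js ks = (\<Prod>s=1..m.
     ennreal (a (nat (int n - ks ! (s - 1)))) / ennreal \<bar>b (nat (int n - js ! (s - 1)))\<bar>)"

lemma path_weight_Suc:
  assumes "length js = m" "length ks = m"
  shows "path_weight a b (Suc m) n (js @ [j]) (ks @ [k]) =
    path_weight a b m n js ks * (ennreal (a (nat (int n - k))) / ennreal \<bar>b (nat (int n - j))\<bar>)"
proof -
  have "path_weight a b m n (js @ [j]) (ks @ [k]) = path_weight a b m n js ks"
    unfolding path_weight_def using assms by (intro prod.cong) (auto simp: nth_append)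
  then show ?thesis using assms
    unfolding path_weight_def by (simp add: nth_append)
qed

text \<open>
  A multi-index encodes a nearest-neighbour path which starts at \<open>n\<close>, visits the positions
  \<open>n - j\<^sub>s\<close> and ends at \<open>n - (2 k\<^sub>m - j\<^sub>m - 1)\<close>: the \<open>s\<close>-th step goes up
  if \<open>k\<^sub>s = j\<^sub>s\<close> and down if \<open>k\<^sub>s = j\<^sub>s + 1\<close>.
\<close>

lemma recurrence_iterate:
  fixes v :: "nat \<Rightarrow> ennreal"
  assumes v: "\<And>p. p \<ge> 2 \<Longrightarrow>
      v p \<le> ennreal (a p) / ennreal \<bar>b p\<bar> * v (p + 1) + ennreal (a (p - 1)) / ennreal \<bar>b p\<bar> * v (p - 1)"
    and "m \<ge> 1" "n > m"
  shows "v n \<le> (\<Sum>(js, ks)\<in>multi_indices m. path_weight a b m n js ks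
      * v (nat (int n - (2 * ks ! (m - 1) - js ! (m - 1) - 1))))"
  using \<open>m \<ge> 1\<close> \<open>n > m\<close>
proof (induction m rule: dec_induct)
  case base
  have "nat (int n + 1) = n + 1" "nat (int n - 1) = n - 1" by auto
  then show ?case using v[of n] base
    unfolding path_weight_def multi_indices_1 by simp
next
  case (step m)
  let ?j = "\<lambda>js ks. 2 * ks ! (m - 1) - js ! (m - 1) - (1 :: int)"
  have "v n \<le> (\<Sum>(js, ks)\<in>multi_indices m. path_weight a b m n js ks * v (nat (int n - ?j js ks)))"
    using step by simp
  also have "\<dots> \<le> (\<Sum>(js, ks)\<in>multi_indices m. let j = ?j js ks in
      path_weight a b (Suc m) n (js @ [j]) (ks @ [j]) * v (nat (int n - (2 * j - j - 1))) +
      path_weight a b (Suc m) n (js @ [j]) (ks @ [j + 1]) * v (nat (int n - (2 * (j + 1) - j - 1))))"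
  proof (intro sum_mono, clarify)
    fix js ks assume mem: "(js, ks) \<in> multi_indices m"
    then have len: "length js = m" "length ks = m" by (auto simp: multi_indices_def)
    define j where "j = ?j js ks"
    \<comment> \<open>The path so far ends at \<open>n - j\<close>. Since \<open>n > Suc m\<close>,
      this is at least 2, so the hypothesis on \<open>v\<close> applies there and \<open>nat\<close>
      truncates nothing.\<close>
    have "j \<le> int m"
      using multi_indices_bounds[OF mem, of "m - 1"] step.hyps by (auto simp: j_def)
    then have p: "nat (int n - j) \<ge> 2" "nat (int n - (j - 1)) = nat (int n - j) + 1"
      "nat (int n - (j + 1)) = nat (int n - j) - 1"
      using step.prems by auto
    have ends: "2 * j - j - 1 = j - 1" "2 * (j + 1) - j - 1 = j + 1" by auto
    have "path_weight a b m n js ks * v (nat (int n - j)) \<le>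
      path_weight a b (Suc m) n (js @ [j]) (ks @ [j]) * v (nat (int n - (j - 1))) +
      path_weight a b (Suc m) n (js @ [j]) (ks @ [j + 1]) * v (nat (int n - (j + 1)))"
      unfolding path_weight_Suc[OF len] p(2,3) mult.assoc distrib_left[symmetric]
      by (intro mult_left_mono v p(1)) simp
    then show "path_weight a b m n js ks * v (nat (int n - ?j js ks)) \<le> (let j = ?j js ks in
      path_weight a b (Suc m) n (js @ [j]) (ks @ [j]) * v (nat (int n - (2 * j - j - 1))) +
      path_weight a b (Suc m) n (js @ [j]) (ks @ [j + 1]) * v (nat (int n - (2 * (j + 1) - j - 1))))"
      by (simp only: j_def[symmetric] Let_def ends)
  qed
  also have "\<dots> = (\<Sum>(js, ks)\<in>multi_indices (Suc m). path_weight a b (Suc m) n js ks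
      * v (nat (int n - (2 * ks ! m - js ! m - 1))))"
    unfolding sum_multi_indices_Suc[OF \<open>1 \<le> m\<close>]
  proof (intro sum.cong refl, clarify)
    fix js ks assume "(js, ks) \<in> multi_indices m"
    then have "(js @ [x]) ! m = x" "(ks @ [x]) ! m = x" for x
      by (auto simp: multi_indices_def nth_append)
    then show "(let j = ?j js ks in
      path_weight a b (Suc m) n (js @ [j]) (ks @ [j]) * v (nat (int n - (2 * j - j - 1))) +
      path_weight a b (Suc m) n (js @ [j]) (ks @ [j + 1]) * v (nat (int n - (2 * (j + 1) - j - 1)))) =
      (let j = ?j js ks in
      path_weight a b (Suc m) n (js @ [j]) (ks @ [j]) *
        v (nat (int n - (2 * (ks @ [j]) ! m - (js @ [j]) ! m - 1))) +
      path_weight a b (Suc m) n (js @ [j]) (ks @ [j + 1]) *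
        v (nat (int n - (2 * (ks @ [j + 1]) ! m - (js @ [j]) ! m - 1))))"
      by (simp only: Let_def)
  qed
  finally show ?case by simp
qed

text \<open>A path of \<open>m\<close> unit steps ends within distance \<open>m\<close> of
  \<open>n\<close>. Bounding every end value by the sum over this window lets that sum factor out,
  and the remaining path weights add up to \<open>G\<close>.\<close>

lemma recurrence_le_G:
  fixes v :: "nat \<Rightarrow> ennreal"
  assumes v: "\<And>p. p \<ge> 2 \<Longrightarrow>
      v p \<le> ennreal (a p) / ennreal \<bar>b p\<bar> * v (p + 1) + ennreal (a (p - 1)) / ennreal \<bar>b p\<bar> * v (p - 1)"
    and "m \<ge> 1" "n > m"
  shows "v n \<le> G a b m n * (\<Sum>i\<le>2*m. v (n - m + i))"
proof -
  have "v n \<le> (\<Sum>(js, ks)\<in>multi_indices m. path_weight a b m n js ks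
      * v (nat (int n - (2 * ks ! (m - 1) - js ! (m - 1) - 1))))"
    by (rule recurrence_iterate[OF assms])
  also have "\<dots> \<le> (\<Sum>(js, ks)\<in>multi_indices m. path_weight a b m n js ks * (\<Sum>i\<le>2*m. v (n - m + i)))"
  proof (intro sum_mono, clarify, intro mult_left_mono)
    fix js ks assume mem: "(js, ks) \<in> multi_indices m"
    define j where "j = 2 * ks ! (m - 1) - js ! (m - 1) - 1"
    have j: "\<bar>j\<bar> \<le> int m"
      using multi_indices_bounds[OF mem, of "m - 1"] assms by (auto simp: j_def)
    \<comment> \<open>The window is counted from its left end \<open>n - m\<close>, so the position
      \<open>n - j\<close> has offset \<open>m - j\<close>.\<close>
    define i where "i = nat (int m - j)"
    have "i \<in> {..2*m}" "nat (int n - j) = n - m + i" using j assms by (auto simp: i_def)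
    then have "v (nat (int n - j)) \<le> (\<Sum>i\<le>2*m. v (n - m + i))"
      by (metis finite_atMost member_le_sum zero_le)
    then show "v (nat (int n - (2 * ks ! (m - 1) - js ! (m - 1) - 1))) \<le> (\<Sum>i\<le>2*m. v (n - m + i))"
      by (simp add: j_def)
  qed simp
  also have "\<dots> = G a b m n * (\<Sum>i\<le>2*m. v (n - m + i))"
    by (simp add: G_def path_weight_def sum_distrib_right case_prod_unfold)
  finally show ?thesis .
qed

section \<open>Absence of nonzero square-summable solutions\<close>

lemma recurrence_solution_zero:
  fixes u :: "nat \<Rightarrow> complex" and a b :: "nat \<Rightarrow> real" and \<zeta> :: complex
  assumes rec: "\<And>n. n \<ge> 1 \<Longrightarrow>
      a n * u (n + 1) + b n * u n + (if n = 1 then 0 else a (n - 1) * u (n - 1)) = \<zeta> * u n"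
    and a: "\<And>n. n \<ge> 1 \<Longrightarrow> a n > 0" and m: "m \<ge> 1"
    and div: "(\<Sum>i. 1 / (ennreal (a (m + 1 + i)) * G a b m (m + 1 + i))) = \<infinity>"
    and \<zeta>: "Re \<zeta> = 0" "Im \<zeta> \<noteq> 0"
    and u: "summable (\<lambda>n. (cmod (u n))\<^sup>2)"
    and "n \<ge> 1"
  shows "u n = 0"
proof (rule ccontr)
  assume "u n \<noteq> 0"
  then have u1: "u 1 \<noteq> 0" using recurrence_zero[OF rec a] \<open>n \<ge> 1\<close> by blast
  \<comment> \<open>The Wronskian identity involves a sum of squares that is at least its first
    term, which gives a lower bound independent of the index.\<close>
  define c where "c = \<bar>Im \<zeta>\<bar> * (cmod (u 1))\<^sup>2"
  have c: "c > 0" using u1 \<zeta> by (simp add: c_def)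
  have W: "c \<le> a k * cmod (u k) * cmod (u (k + 1))" if k: "k \<ge> 1" for k
  proof -
    have "(cmod (u 1))\<^sup>2 \<le> (\<Sum>i=1..k. (cmod (u i))\<^sup>2)"
      using k by (intro member_le_sum) auto
    then have "c \<le> \<bar>Im \<zeta>\<bar> * (\<Sum>i=1..k. (cmod (u i))\<^sup>2)"
      unfolding c_def by (intro mult_left_mono) auto
    also have "\<dots> = \<bar>Im \<zeta> * (\<Sum>i=1..k. (cmod (u i))\<^sup>2)\<bar>"
      by (simp add: abs_mult sum_nonneg)
    also have "\<dots> = \<bar>a k * Im (u (k + 1) * cnj (u k))\<bar>"
      by (simp only: recurrence_wronskian[OF rec k])
    also have "\<dots> = a k * \<bar>Im (u (k + 1) * cnj (u k))\<bar>"
      by (simp only: abs_mult abs_of_pos[OF a[OF k]])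
    also have "\<dots> \<le> a k * cmod (u (k + 1) * cnj (u k))"
      using a[OF k] by (intro mult_left_mono abs_Im_le_cmod) auto
    finally show ?thesis by (simp add: norm_mult mult_ac)
  qed
  have un0: "cmod (u k) > 0" if "k \<ge> 1" for k
    using W[OF that] c by (cases "u k = 0") auto

  define v where "v k = ennreal (cmod (u k))" for k
  \<comment> \<open>Since \<open>\<zeta>\<close> is purely imaginary, \<open>\<bar>b p - \<zeta>\<bar> \<ge> \<bar>b p\<bar>\<close>; hence \<open>\<zeta>\<close> leaves no error term.\<close>
  have step: "v p \<le> ennreal (a p) / ennreal \<bar>b p\<bar> * v (p + 1)
      + ennreal (a (p - 1)) / ennreal \<bar>b p\<bar> * v (p - 1)" if p: "p \<ge> 2" for p
  proof (cases "b p = 0")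
    case True
    \<comment> \<open>The quotient is \<open>top\<close>, but \<open>top * 0 = 0\<close> in
      \<open>ennreal\<close>; the product is infinite only because the Wronskian bound excludes
      \<open>u (p + 1) = 0\<close>.\<close>
    then have "ennreal (a p) / ennreal \<bar>b p\<bar> * v (p + 1) = top"
      using a[of p] un0[of "p + 1"] p by (simp add: v_def ennreal_mult_eq_top_iff ennreal_top_mult)
    then show ?thesis by simp
  next
    case False
    have ap: "a (p - 1) > 0" using p by (intro a) simp
    have "(\<zeta> - b p) * u p = a p * u (p + 1) + a (p - 1) * u (p - 1)"
      using rec[of p] p by (simp add: algebra_simps)
    then have "cmod (\<zeta> - b p) * cmod (u p) = cmod (a p * u (p + 1) + a (p - 1) * u (p - 1))"
      by (simp add: norm_mult[symmetric])
    also have "\<dots> \<le> a p * cmod (u (p + 1)) + a (p - 1) * cmod (u (p - 1))"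
      using a[of p] ap p by (intro norm_triangle_le) (simp add: norm_mult)
    finally have "cmod (\<zeta> - b p) * cmod (u p) \<le> a p * cmod (u (p + 1)) + a (p - 1) * cmod (u (p - 1))" .
    moreover have "\<bar>b p\<bar> \<le> cmod (\<zeta> - b p)"
      using abs_Re_le_cmod[of "\<zeta> - b p"] \<zeta> by simp
    ultimately have "\<bar>b p\<bar> * cmod (u p) \<le> a p * cmod (u (p + 1)) + a (p - 1) * cmod (u (p - 1))"
      by (meson mult_right_mono norm_ge_zero order_trans)
    then have "cmod (u p) \<le> a p / \<bar>b p\<bar> * cmod (u (p + 1)) + a (p - 1) / \<bar>b p\<bar> * cmod (u (p - 1))"
      using False by (simp add: field_simps)
    then have "v p \<le> ennreal (a p / \<bar>b p\<bar> * cmod (u (p + 1)) + a (p - 1) / \<bar>b p\<bar> * cmod (u (p - 1)))"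
      unfolding v_def by (rule ennreal_leI)
    also have "\<dots> = ennreal (a p) / ennreal \<bar>b p\<bar> * v (p + 1) + ennreal (a (p - 1)) / ennreal \<bar>b p\<bar> * v (p - 1)"
      using a[of p] ap p False
      by (simp add: v_def divide_ennreal ennreal_mult[symmetric])
    finally show ?thesis .
  qed

  define S where "S k = (\<Sum>i\<le>2*m. cmod (u (k - m + i)))" for k
  have bound: "1 / (ennreal (a k) * G a b m k) \<le> ennreal (cmod (u (k + 1)) * S k / c)" if k: "k > m" for k
  proof -
    have k1: "k \<ge> 1" using k by simp
    have vG: "v k \<le> G a b m k * ennreal (S k)"
      using recurrence_le_G[of v a b, OF step m k] by (simp add: v_def S_def)
    \<comment> \<open>\<open>G\<close> cannot be 0, since \<open>vG\<close> would then force
      \<open>u k = 0\<close>. If it is \<open>top\<close>, the term of the series is 0.\<close>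
    consider "G a b m k = top" | g where "G a b m k = ennreal g" "g > 0"
    proof (cases "G a b m k")
      case (real r)
      have "r \<noteq> 0" using vG un0[OF k1] real by (auto simp: v_def)
      then show ?thesis using that real by auto
    qed auto
    then show ?thesis
    proof cases
      case 1
      then show ?thesis using a[OF k1] by (simp add: ennreal_mult_top)
    next
      case 2
      have "cmod (u k) \<le> g * S k"
        using vG 2 by (simp add: v_def S_def sum_nonneg ennreal_mult'[symmetric])
      have "c \<le> a k * cmod (u k) * cmod (u (k + 1))" using W[OF k1] .
      also have "\<dots> \<le> a k * (g * S k) * cmod (u (k + 1))"
        using \<open>cmod (u k) \<le> g * S k\<close> a[OF k1] by (intro mult_right_mono mult_left_mono) auto
      finally have "1 / (a k * g) \<le> cmod (u (k + 1)) * S k / c"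
        using c a[OF k1] 2 by (simp add: field_simps)
      moreover have "1 / (ennreal (a k) * G a b m k) = ennreal (1 / (a k * g))"
        using 2 a[OF k1] by (simp add: ennreal_mult[symmetric] divide_ennreal[symmetric])
      ultimately show ?thesis by (simp add: ennreal_leI)
    qed
  qed

  define t where "t i = cmod (u (m + 1 + i + 1)) * S (m + 1 + i) / c" for i
  have shift: "summable (\<lambda>i. (cmod (u (i + k)))\<^sup>2)" for k
    using u by (subst summable_iff_shift)
  \<comment> \<open>A product of two shifted moduli is dominated by the sum of their
    squares.\<close>
  have "summable (\<lambda>i. cmod (u (i + k)) * cmod (u (i + l)))" for k l
  proof (rule summable_comparison_test')
    show "summable (\<lambda>i. (cmod (u (i + k)))\<^sup>2 + (cmod (u (i + l)))\<^sup>2)"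
      by (intro summable_add shift)
    show "norm (cmod (u (i + k)) * cmod (u (i + l))) \<le> (cmod (u (i + k)))\<^sup>2 + (cmod (u (i + l)))\<^sup>2" for i
    proof -
      have "0 \<le> cmod (u (i + k)) * cmod (u (i + l))" by simp
      then show ?thesis
        using sum_squares_bound[of "cmod (u (i + k))" "cmod (u (i + l))"]
        unfolding real_norm_def by linarith
    qed
  qed
  \<comment> \<open>For the index k = m + 1 + i, the positions k + 1 and k - m + j are i + (m + 2)
    and i + (1 + j), so \<open>t\<close> is a finite sum of products of two fixed shifts.\<close>
  then have "summable (\<lambda>i. \<Sum>j\<le>2*m. cmod (u (i + (m + 2))) * cmod (u (i + (1 + j))))"
    by (intro summable_sum)
  then have "summable (\<lambda>i. (\<Sum>j\<le>2*m. cmod (u (i + (m + 2))) * cmod (u (i + (1 + j)))) / c)"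
    by (rule summable_divide)
  moreover have "(\<lambda>i. (\<Sum>j\<le>2*m. cmod (u (i + (m + 2))) * cmod (u (i + (1 + j)))) / c) = t"
    by (simp add: fun_eq_iff t_def S_def sum_distrib_left add_ac)
  ultimately have t: "summable t" by (rule back_subst[of summable])
  have t0: "t i \<ge> 0" for i using c by (simp add: t_def S_def sum_nonneg)
  have "(\<Sum>i. 1 / (ennreal (a (m + 1 + i)) * G a b m (m + 1 + i))) \<le> (\<Sum>i. ennreal (t i))"
    unfolding t_def by (intro suminf_le bound) auto
  also have "\<dots> = ennreal (suminf t)" by (rule suminf_ennreal2[OF t0 t])
  finally show False using div by (simp add: top_unique)
qed


section \<open>The tridiagonal operator\<close>

lemma tridiagonal_on_span_add:
  assumes "(x, y) \<in> tridiagonal_on_span e a b" "(x', y') \<in> tridiagonal_on_span e a b"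
  shows "(x + x', y + y') \<in> tridiagonal_on_span e a b"
proof -
  obtain N c M d where *:
    "x = (\<Sum>n=1..N. c n *\<^sub>C e n)" "y = (\<Sum>n=1..N. c n *\<^sub>C tridiagonal_image e a b n)"
    "x' = (\<Sum>n=1..M. d n *\<^sub>C e n)" "y' = (\<Sum>n=1..M. d n *\<^sub>C tridiagonal_image e a b n)"
    using assms unfolding tridiagonal_on_span_def by blast
  \<comment> \<open>The two combinations may have different lengths; both are padded with
    zeros.\<close>
  define f where "f n = (if n \<le> N then c n else 0) + (if n \<le> M then d n else 0)" for n
  have cut: "(\<Sum>n=1..N. c n *\<^sub>C g n) = (\<Sum>n=1..max N M. (if n \<le> N then c n else 0) *\<^sub>C g n)"
    "(\<Sum>n=1..M. d n *\<^sub>C g n) = (\<Sum>n=1..max N M. (if n \<le> M then d n else 0) *\<^sub>C g n)"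
    for g :: "nat \<Rightarrow> 'a"
    by (intro sum.mono_neutral_cong_left; auto)+
  have "x + x' = (\<Sum>n=1..max N M. f n *\<^sub>C e n)"
    "y + y' = (\<Sum>n=1..max N M. f n *\<^sub>C tridiagonal_image e a b n)"
    unfolding * cut f_def by (simp_all only: scaleC_add_left sum.distrib)
  then show ?thesis unfolding tridiagonal_on_span_def by blast
qed

lemma tridiagonal_on_span_scale:
  assumes "(x, y) \<in> tridiagonal_on_span e a b"
  shows "(c *\<^sub>C x, c *\<^sub>C y) \<in> tridiagonal_on_span e a b"
proof -
  obtain N d where *:
    "x = (\<Sum>n=1..N. d n *\<^sub>C e n)" "y = (\<Sum>n=1..N. d n *\<^sub>C tridiagonal_image e a b n)"
    using assms unfolding tridiagonal_on_span_def by blast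
  have "c *\<^sub>C x = (\<Sum>n=1..N. (c * d n) *\<^sub>C e n)"
    "c *\<^sub>C y = (\<Sum>n=1..N. (c * d n) *\<^sub>C tridiagonal_image e a b n)"
    unfolding * by (simp_all add: complex_vector.scale_sum_right)
  then show ?thesis
    unfolding tridiagonal_on_span_def mem_Collect_eq
    by (intro exI[of _ N] exI[of _ "\<lambda>n. c * d n"]) simp
qed

lemma tridiagonal_on_span_basis:
  assumes "n \<ge> 1"
  shows "(e n, tridiagonal_image e a b n) \<in> tridiagonal_on_span e a b"
proof -
  have "(\<Sum>i=1..n. (if i = n then 1 else 0) *\<^sub>C g i) = (\<Sum>i\<in>{n}. (1 :: complex) *\<^sub>C g i)"
    for g :: "nat \<Rightarrow> 'a"
    using assms by (intro sum.mono_neutral_cong_right) auto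
  then show ?thesis
    unfolding tridiagonal_on_span_def mem_Collect_eq
    by (intro exI[of _ n] exI[of _ "\<lambda>i. if i = n then 1 else 0"]) (simp add: scaleC_one)
qed

text \<open>Linearity in the first argument reduces the adjoint relation to basis vectors, where it
  becomes a recurrence for the coefficients of \<open>y\<close>.\<close>

lemma adjoint_tridiagonal_iff:
  "(y, z) \<in> adjoint_operator (tridiagonal_on_span e a b) \<longleftrightarrow>
    (\<forall>n\<ge>1. cinner (tridiagonal_image e a b n) y = cinner (e n) z)"
proof
  assume "(y, z) \<in> adjoint_operator (tridiagonal_on_span e a b)"
  then show "\<forall>n\<ge>1. cinner (tridiagonal_image e a b n) y = cinner (e n) z"
    using tridiagonal_on_span_basis by (fastforce simp: adjoint_operator_def)
next
  assume "\<forall>n\<ge>1. cinner (tridiagonal_image e a b n) y = cinner (e n) z"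
  then show "(y, z) \<in> adjoint_operator (tridiagonal_on_span e a b)"
    by (auto simp: adjoint_operator_def tridiagonal_on_span_def cinner.sum_left cinner_scaleC_left)
qed

text \<open>Tested on basis vectors on both sides, the claim is the symmetry of a real tridiagonal
  matrix.\<close>

lemma tridiagonal_on_span_symmetric:
  fixes e :: "nat \<Rightarrow> 'a::complex_hilbert_space"
  assumes "orthonormal_basis e"
  shows "tridiagonal_on_span e a b \<subseteq> adjoint_operator (tridiagonal_on_span e a b)"
proof clarify
  fix x y assume "(x, y) \<in> tridiagonal_on_span e a b"
  then obtain N c where *:
    "x = (\<Sum>n=1..N. c n *\<^sub>C e n)" "y = (\<Sum>n=1..N. c n *\<^sub>C tridiagonal_image e a b n)"
    unfolding tridiagonal_on_span_def by blast
  have on: "cinner (e n) (e k) = (if n = k then 1 else 0)" if "n \<noteq> 0" "k \<noteq> 0" for n k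
    using assms that unfolding orthonormal_basis_def by (simp add: Suc_le_eq)
  have "cinner (tridiagonal_image e a b n) (e k) = cinner (e n) (tridiagonal_image e a b k)"
    if "n \<ge> 1" "k \<ge> 1" for n k
    using that unfolding tridiagonal_image_def
    by (cases n; cases k) (auto simp: cinner_algebra cinner.zero_left on)
  then show "(x, y) \<in> adjoint_operator (tridiagonal_on_span e a b)"
    unfolding adjoint_tridiagonal_iff * by (auto simp: cinner.sum_right cinner_scaleC_right)
qed

theorem theorem4p3:
  fixes e :: "nat \<Rightarrow> 'a::complex_hilbert_space"
    and a b :: "nat \<Rightarrow> real"
    and m :: nat
  assumes "orthonormal_basis e"
    and "\<And>n. n \<ge> 1 \<Longrightarrow> a n > 0"
    and "m \<ge> 1"
    and "(\<Sum>i. 1 / (ennreal (a (m + 1 + i)) * G a b m (m + 1 + i))) = \<infinity>"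
  shows "self_adjoint (tridiagonal_operator e a b)"
proof -
  have on: "cinner (e n) (e k) = (if n = k then 1 else 0)" if "n \<ge> 1" "k \<ge> 1" for n k
    using assms(1) that unfolding orthonormal_basis_def by blast
  have dense: "closure (cspan (e ` {1..})) = UNIV"
    using assms(1) unfolding orthonormal_basis_def by blast
  have kernel: "y = 0"
    if mem: "(y, \<zeta> *\<^sub>C y) \<in> adjoint_operator (tridiagonal_on_span e a b)"
      and \<zeta>: "Re \<zeta> = 0" "Im \<zeta> \<noteq> 0" for y \<zeta>
  proof (rule dense_orthogonal_zero[OF dense])
    fix x assume "x \<in> e ` {1..}"
    then obtain n where n: "x = e n" "n \<ge> 1" by auto
    \<comment> \<open>\<open>orthonormal_basis\<close> does not constrain \<open>e 0\<close>, so
      \<open>u 0\<close> is set to 0 for Bessel's inequality. These are the conjugates of the usual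
      coefficients of \<open>y\<close>, hence the recurrence carries \<open>cnj\<close> of \<zeta>,
      again purely imaginary and nonzero.\<close>
    define u where "u k = (if k = 0 then 0 else cinner (e k) y)" for k
    have rec: "a k * u (k + 1) + b k * u k + (if k = 1 then 0 else a (k - 1) * u (k - 1)) = cnj \<zeta> * u k"
      if k: "k \<ge> 1" for k
    proof -
      have "cinner (tridiagonal_image e a b k) y = cinner (e k) (\<zeta> *\<^sub>C y)"
        using mem k unfolding adjoint_tridiagonal_iff by blast
      then show ?thesis
        using k unfolding tridiagonal_image_def
        by (auto simp: u_def cinner_algebra cinner.zero_left scaleR_conv_of_real split: if_splits)
    qed
    have "summable (\<lambda>k. (cmod (u k))\<^sup>2)"
    proof (rule summableI_nonneg_bounded)
      fix N
      have "(\<Sum>k<N. (cmod (u k))\<^sup>2) = (\<Sum>k\<in>{1..<N}. (cmod (cinner (e k) y))\<^sup>2)"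
        by (rule sum.mono_neutral_cong_right) (auto simp: u_def)
      also have "\<dots> \<le> (norm y)\<^sup>2"
        by (rule bessel_inequality) (auto simp: on)
      finally show "(\<Sum>k<N. (cmod (u k))\<^sup>2) \<le> (norm y)\<^sup>2" .
    qed simp
    then have "u n = 0"
      using \<zeta> n by (intro recurrence_solution_zero[where \<zeta> = "cnj \<zeta>", OF rec assms(2-4)]) auto
    then show "cinner x y = 0" using n by (simp add: u_def)
  qed
  show ?thesis
    unfolding tridiagonal_operator_def
  proof (rule self_adjoint_closureI)
    show "(0, 0) \<in> tridiagonal_on_span e a b"
      using tridiagonal_on_span_scale[OF tridiagonal_on_span_basis[of 1], of 0 e a b]
      by (simp add: complex_vector.scale_zero_left)
    show "closure (Domain (tridiagonal_on_span e a b)) = UNIV"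
      unfolding Domain_tridiagonal_on_span by (rule dense)
    show "y = 0" if "(y, \<i> *\<^sub>C y) \<in> adjoint_operator (tridiagonal_on_span e a b)" for y
      using that by (rule kernel) simp_all
    show "y = 0" if "(y, (-\<i>) *\<^sub>C y) \<in> adjoint_operator (tridiagonal_on_span e a b)" for y
      using that by (rule kernel) simp_all
    show "tridiagonal_on_span e a b \<subseteq> adjoint_operator (tridiagonal_on_span e a b)"
      by (rule tridiagonal_on_span_symmetric[OF assms(1)])
  qed (blast intro: tridiagonal_on_span_add tridiagonal_on_span_scale)+
qed

end
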